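(* Let $X$ be a complete metric space. (1) If $X$ is noncompact and locally compact, then $\mathrm{cof}(\mathrm{K}(X))=\mathrm{d}(X)$. (2) If $X$ is not locally compact, then $$\mathrm{cof}(\mathrm{K}(X))=\mathrm{d}(X)\cdot\mathfrak d\cdot\sup_{x\in X}\mathrm{cof}\bigl([\mathrm{ld}(x)]^{\aleph_0}\bigr).$$
   Context: $\mathrm{K}(X)$ is the family of compact subsets of $X$, partially ordered by inclusion. For a partially ordered set $P$, $\mathrm{cof}(P)$ is the minimal cardinality of a cofinal subset of $P$ (a subset $C$ such that each $p\in P$ satisfies $p\le c$ for some $c\in C$). $\mathrm{d}(X)$ is the minimal cardinality of a dense subset of $X$. For a point $x\in X$, the local density $\mathrm{ld}(x)$ is the minimal density of a neighborhood of $x$. $\mathfrak d:=\mathrm{cof}(\mathbb N^{\mathbb N},\le)$, where $f\le g$ iff $f(n)\le g(n)$ for all $n$. For a cardinal $\kappa$, $[\kappa]^{\aleph_0}$ is the family of all countably infinite subsets of $\kappa$, partially ordered by inclusion; if $\kappa$ is finite (as happens for $\kappa=\mathrm{ld}(x)$ when $x$ is isolated), it is empty and has cofinality $0$, so it does not contribute to the supremum. *)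

theory Defs
  imports "HOL-Analysis.Analysis"
begin

unbundle cardinal_syntax

text \<open>
  Cardinal numbers are cardinal well-orders (\<^const>\<open>Card_order\<close>), compared by \<open>\<le>o\<close> and \<open>=o\<close>,
  which also relate cardinals living on different types. The choice in \<open>min_card\<close> fixes a
  minimal member of a nonempty set of cardinals; it is unique up to \<open>=o\<close>.
\<close>

definition min_card :: "'a rel set \<Rightarrow> 'a rel" where
  "min_card R = (SOME r. r \<in> R \<and> (\<forall>r'\<in>R. r \<le>o r'))"

lemma min_card:
  assumes "R \<noteq> {}" "\<And>r. r \<in> R \<Longrightarrow> Card_order r"
  shows min_card_in: "min_card R \<in> R"
    and min_card_le: "\<And>r. r \<in> R \<Longrightarrow> min_card R \<le>o r"
proof -
  have "\<exists>r. r \<in> R \<and> (\<forall>r'\<in>R. r \<le>o r')"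
    using exists_minim_Card_order[of R] assms by blast
  from someI_ex[OF this]
  show "min_card R \<in> R" "\<And>r. r \<in> R \<Longrightarrow> min_card R \<le>o r"
    unfolding min_card_def by blast+
qed

text \<open>
  The supremum is the least upper bound among the cardinals on the type \<open>'b\<close> carrying the family;
  by \<open>sup_card_least\<close> below it is also least among upper bounds on any other type.
\<close>

definition sup_card :: "'i set \<Rightarrow> ('i \<Rightarrow> 'b rel) \<Rightarrow> 'b rel" where
  "sup_card I F = min_card {s. Card_order s \<and> (\<forall>i\<in>I. F i \<le>o s)}"

definition cofinal_in :: "'p set \<Rightarrow> ('p \<Rightarrow> 'p \<Rightarrow> bool) \<Rightarrow> 'p set \<Rightarrow> bool" where
  "cofinal_in P le C \<longleftrightarrow> C \<subseteq> P \<and> (\<forall>p\<in>P. \<exists>c\<in>C. le p c)"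

definition cof :: "'p set \<Rightarrow> ('p \<Rightarrow> 'p \<Rightarrow> bool) \<Rightarrow> 'p rel" where
  "cof P le = min_card {|C| | C. cofinal_in P le C}"

text \<open>Below, a set \<open>X\<close> in a topological space is regarded as a space with the subspace topology.\<close>

definition dense_char :: "'a::topological_space set \<Rightarrow> 'a rel" where
  "dense_char X = min_card {|D| | D. D \<subseteq> X \<and> X \<subseteq> closure D}"

definition nbhd_in :: "'a::topological_space set \<Rightarrow> 'a \<Rightarrow> 'a set \<Rightarrow> bool" where
  "nbhd_in X x N \<longleftrightarrow> N \<subseteq> X \<and> (\<exists>U. openin (top_of_set X) U \<and> x \<in> U \<and> U \<subseteq> N)"

definition local_density :: "'a::topological_space set \<Rightarrow> 'a \<Rightarrow> 'a rel" where
  "local_density X x = min_card {dense_char N | N. nbhd_in X x N}"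

definition compacts :: "'a::topological_space set \<Rightarrow> 'a set set" where
  "compacts X = {K. K \<subseteq> X \<and> compact K}"

text \<open>On functions, \<open>(\<le>)\<close> is the pointwise order.\<close>

definition dominating_number :: "(nat \<Rightarrow> nat) rel" where
  "dominating_number = cof (UNIV :: (nat \<Rightarrow> nat) set) (\<le>)"

text \<open>The underlying set of a cardinal \<open>\<kappa>\<close>, given as a well-order, is \<^term>\<open>Field \<kappa>\<close>.\<close>

definition ctbl_infinite_subsets :: "'a rel \<Rightarrow> 'a set set" where
  "ctbl_infinite_subsets \<kappa> = {A. A \<subseteq> Field \<kappa> \<and> countable A \<and> infinite A}"

lemma cof:
  assumes "\<And>p. p \<in> P \<Longrightarrow> le p p"
  shows cof_attained: "\<exists>C. cofinal_in P le C \<and> cof P le = |C|"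
    and cof_least: "\<And>C. cofinal_in P le C \<Longrightarrow> cof P le \<le>o |C|"
proof -
  let ?R = "{|C| | C. cofinal_in P le C}"
  have "cofinal_in P le P" using assms by (auto simp: cofinal_in_def)
  then have ne: "?R \<noteq> {}" by blast
  have co: "\<And>r. r \<in> ?R \<Longrightarrow> Card_order r" by (auto simp: card_of_Card_order)
  have "min_card ?R \<in> ?R" by (rule min_card_in[OF ne]) (rule co)
  then show "\<exists>C. cofinal_in P le C \<and> cof P le = |C|" by (auto simp: cof_def)
  show "cof P le \<le>o |C|" if "cofinal_in P le C" for C
    unfolding cof_def by (rule min_card_le[OF ne]) (rule co, use that in auto)
qed

lemma sup_card:
  fixes F :: "'i \<Rightarrow> 'b rel"
  assumes F: "\<And>i. i \<in> I \<Longrightarrow> Card_order (F i)"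
  shows sup_card_Card_order: "Card_order (sup_card I F)"
    and sup_card_upper: "\<And>i. i \<in> I \<Longrightarrow> F i \<le>o sup_card I F"
    and sup_card_least:
      "\<And>t :: 'c rel. Card_order t \<Longrightarrow> (\<And>i. i \<in> I \<Longrightarrow> F i \<le>o t) \<Longrightarrow> sup_card I F \<le>o t"
proof -
  let ?R = "{s :: 'b rel. Card_order s \<and> (\<forall>i\<in>I. F i \<le>o s)}"
  have "F i \<le>o |UNIV :: 'b set|" if "i \<in> I" for i
    using F[OF that] card_of_Field_ordIso[of "F i"] card_of_mono1[of "Field (F i)" UNIV]
    by (meson ordIso_ordLeq_trans ordIso_symmetric subset_UNIV)
  then have ne: "?R \<noteq> {}" using card_of_Card_order by blast
  have co: "\<And>r. r \<in> ?R \<Longrightarrow> Card_order r" by auto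
  have in_R: "min_card ?R \<in> ?R" by (rule min_card_in[OF ne]) (rule co)
  have le: "min_card ?R \<le>o r" if "r \<in> ?R" for r by (rule min_card_le[OF ne _ that]) (rule co)
  from in_R show "Card_order (sup_card I F)" "\<And>i. i \<in> I \<Longrightarrow> F i \<le>o sup_card I F"
    by (auto simp: sup_card_def)
  fix t :: "'c rel"
  assume t: "Card_order t" and ub: "\<And>i. i \<in> I \<Longrightarrow> F i \<le>o t"
  show "sup_card I F \<le>o t"
  proof (cases "|UNIV :: 'b set| \<le>o t")
    case True
    have "sup_card I F \<le>o |UNIV :: 'b set|"
      unfolding sup_card_def
      by (rule le) (use \<open>\<And>i. i \<in> I \<Longrightarrow> F i \<le>o |UNIV :: 'b set|\<close> card_of_Card_order in auto)
    then show ?thesis using True by (rule ordLeq_transitive)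
  next
    case False
    then have "t \<le>o |UNIV :: 'b set|"
      using t by (meson card_of_Well_order card_order_on_well_order_on ordLeq_total)
    moreover have tF: "|Field t| =o t" using t by (rule card_of_Field_ordIso)
    ultimately have "|Field t| \<le>o |UNIV :: 'b set|" by (rule ordIso_ordLeq_trans[rotated])
    then obtain g :: "'c \<Rightarrow> 'b" where g: "inj_on g (Field t)"
      unfolding card_of_ordLeq[symmetric] by blast
    then have "|Field t| =o |g ` Field t|"
      using card_of_ordIso inj_on_imp_bij_betw by blast
    then have iso: "t =o |g ` Field t|"
      using tF by (meson ordIso_symmetric ordIso_transitive)
    then have "|g ` Field t| \<in> ?R"
      using ub ordLeq_ordIso_trans card_of_Card_order by blast
    then have "sup_card I F \<le>o |g ` Field t|" unfolding sup_card_def by (rule le)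
    then show ?thesis using iso ordIso_symmetric ordLeq_ordIso_trans by blast
  qed
qed

end

theory Submission
  imports Defs
begin

text \<open>
  \<^bold>\<open>Upper bounds.\<close> Cofinality in the compact sets is a local matter: if every point has a ball
  whose compact subsets are dominated by at most \<open>\<mu>\<close> compact sets, then already balls of radius
  \<open>1/(n+1)\<close> about the points of a dense set do the job, every compact set is covered by finitely
  many of them, and finite unions of the local dominating sets are cofinal
  (\<open>cof_compacts_le_local\<close>). In a locally compact space a single set suffices locally. In general,
  take a neighborhood of \<open>x\<close> with a dense set \<open>D\<close> of the least possible size, which is the local
  density at \<open>x\<close>. A compact subset of that neighborhood lies in the closure of a countable
  \<open>A \<subseteq> D\<close>, and by total boundedness it is captured by the choice of how many points of \<open>A\<close> are
  used as centres at each scale. The pairs of a set \<open>A\<close> from a cofinal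
  family of countable subsets of \<open>D\<close> and a function from a dominating family hence suffice;
  completeness turns each such pair into a compact set (\<open>compact_box_of_balls\<close>).

  \<^bold>\<open>Lower bounds.\<close> Every space has a dense set \<open>D\<close> that is a countable union of uniformly
  separated sets, so each compact set meets \<open>D\<close> in a countable set only
  (\<open>dense_countable_trace\<close>). Tracing a cofinal family on \<open>D\<close> bounds the density. The other two
  bounds use that a sequence of finite sets shrinking to a point \<open>x\<close> forms, together with \<open>x\<close>,
  a compact set (\<open>compact_shrinking_finite_sets\<close>). If no ball about \<open>x\<close> is compact, each of the
  balls around \<open>x\<close> of radius \<open>1/(n+1)\<close> contains an infinite separated sequence, and the initial
  segments of these sequences code functions from \<open>\<nat>\<close> to \<open>\<nat>\<close>. Similarly, each of these
  balls has a dense set with countable compact traces that maps onto a set whose size is the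
  local density; the traces code countable sets, and choosing one
  preimage per ball shows that every countable set is covered.
\<close>

section \<open>Attainment and bounds for cardinal characteristics\<close>

lemma
  shows dense_char_attained: "\<exists>D. D \<subseteq> X \<and> X \<subseteq> closure D \<and> dense_char X = |D|"
    and dense_char_least: "\<And>D. D \<subseteq> X \<Longrightarrow> X \<subseteq> closure D \<Longrightarrow> dense_char X \<le>o |D|"
proof -
  let ?R = "{|D| | D. D \<subseteq> X \<and> X \<subseteq> closure D}"
  have ne: "?R \<noteq> {}" using closure_subset[of X] by blast
  have co: "\<And>r. r \<in> ?R \<Longrightarrow> Card_order r" by (auto simp: card_of_Card_order)
  have "min_card ?R \<in> ?R" by (rule min_card_in[OF ne]) (rule co)
  then show "\<exists>D. D \<subseteq> X \<and> X \<subseteq> closure D \<and> dense_char X = |D|"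
    by (auto simp: dense_char_def)
  show "dense_char X \<le>o |D|" if "D \<subseteq> X" "X \<subseteq> closure D" for D
    unfolding dense_char_def by (rule min_card_le[OF ne]) (rule co, use that in auto)
qed

lemma
  assumes "x \<in> X"
  shows local_density_attained:
      "\<exists>N D. nbhd_in X x N \<and> D \<subseteq> N \<and> N \<subseteq> closure D \<and> local_density X x = |D|"
    and local_density_least:
      "\<And>N D. nbhd_in X x N \<Longrightarrow> D \<subseteq> N \<Longrightarrow> N \<subseteq> closure D \<Longrightarrow> local_density X x \<le>o |D|"
proof -
  let ?R = "{dense_char N | N. nbhd_in X x N}"
  have "nbhd_in X x X" using assms by (auto simp: nbhd_in_def)
  then have ne: "?R \<noteq> {}" by blast
  have co: "Card_order r" if "r \<in> ?R" for r
    using that dense_char_attained card_of_Card_order by (smt (verit) mem_Collect_eq)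
  have "min_card ?R \<in> ?R" by (rule min_card_in[OF ne]) (rule co)
  then obtain N where N: "nbhd_in X x N" "local_density X x = dense_char N"
    unfolding local_density_def by auto
  with dense_char_attained[of N]
  show "\<exists>N D. nbhd_in X x N \<and> D \<subseteq> N \<and> N \<subseteq> closure D \<and> local_density X x = |D|"
    by metis
  show "local_density X x \<le>o |D|" if "nbhd_in X x N" "D \<subseteq> N" "N \<subseteq> closure D" for N D
  proof -
    have "local_density X x \<le>o dense_char N"
      unfolding local_density_def by (rule min_card_le[OF ne]) (rule co, use that in auto)
    then show ?thesis using dense_char_least[OF that(2,3)] by (rule ordLeq_transitive)
  qed
qed

lemma Card_order_cof: "(\<And>p. p \<in> P \<Longrightarrow> le p p) \<Longrightarrow> Card_order (cof P le)"
  using cof_attained[of P le] card_of_Card_order by metis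

lemma cinfinite_card_of_iff: "cinfinite |A| \<longleftrightarrow> infinite A"
  by (simp add: cinfinite_def Field_card_of)

lemma countable_card_of_ordLeq:
  assumes "countable A" "cinfinite \<mu>" "Card_order \<mu>"
  shows "|A| \<le>o \<mu>"
proof -
  have "|A| \<le>o |UNIV :: nat set|"
    using assms(1) unfolding countable_def card_of_ordLeq[symmetric] by blast
  also have "|UNIV :: nat set| \<le>o |Field \<mu>|"
    using assms(2) infinite_iff_card_of_nat unfolding cinfinite_def by blast
  also have "|Field \<mu>| =o \<mu>" using assms(3) by (rule card_of_Field_ordIso)
  finally show ?thesis .
qed

lemma card_of_Union_image_ordLeq:
  assumes "cinfinite \<mu>" "Card_order \<mu>" "|I| \<le>o \<mu>" "\<And>i. i \<in> I \<Longrightarrow> |A i| \<le>o \<mu>"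
  shows "|\<Union>i\<in>I. A i| \<le>o \<mu>"
  using assms card_of_UNION_ordLeq_infinite_Field unfolding cinfinite_def by blast

lemma card_of_image_ordLeq: "|A| \<le>o \<mu> \<Longrightarrow> |f ` A| \<le>o \<mu>"
  using card_of_image ordLeq_transitive by blast

lemma card_of_Times_ordLeq:
  assumes "cinfinite \<mu>" "Card_order \<mu>" "|A| \<le>o \<mu>" "|B| \<le>o \<mu>"
  shows "|A \<times> B| \<le>o \<mu>"
  using assms card_of_Times_ordLeq_infinite_Field unfolding cinfinite_def by blast

lemma card_of_finite_subsets_ordLeq:
  assumes \<mu>: "cinfinite \<mu>" "Card_order \<mu>" and A: "|A| \<le>o \<mu>"
  shows "|{F. finite F \<and> F \<subseteq> A}| \<le>o \<mu>"
proof -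
  \<comment> \<open>\<open>L n\<close> consists of the subsets of \<open>A\<close> that arise from the empty set by \<open>n\<close> insertions.\<close>
  define L where "L = rec_nat {{}} (\<lambda>_ S. (\<lambda>(a, F). insert a F) ` (A \<times> S))"
  have L0: "L 0 = {{}}" and LS: "L (Suc n) = (\<lambda>(a, F). insert a F) ` (A \<times> L n)" for n
    by (simp_all add: L_def)
  have "|L n| \<le>o \<mu>" for n
  proof (induction n)
    case 0 then show ?case unfolding L0 by (intro countable_card_of_ordLeq \<mu>) auto
  next
    case (Suc n)
    then show ?case unfolding LS by (intro card_of_image_ordLeq card_of_Times_ordLeq \<mu> A)
  qed
  then have card: "|\<Union>n. L n| \<le>o \<mu>"
    by (intro card_of_Union_image_ordLeq countable_card_of_ordLeq[of UNIV] \<mu>) auto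
  have "F \<in> (\<Union>n. L n)" if "finite F" "F \<subseteq> A" for F
    using that
  proof (induction F rule: finite_induct)
    case empty then show ?case using L0 by blast
  next
    case (insert a F)
    then obtain n where "F \<in> L n" by auto
    then have "insert a F \<in> L (Suc n)" using insert.prems unfolding LS by force
    then show ?case by blast
  qed
  then have "{F. finite F \<and> F \<subseteq> A} \<subseteq> (\<Union>n. L n)" by blast
  then show ?thesis by (rule ordLeq_transitive[OF card_of_mono1 card])
qed

section \<open>Separated sets and compact sets\<close>

definition separated :: "real \<Rightarrow> 'a::metric_space set \<Rightarrow> bool" where
  "separated e S \<longleftrightarrow> (\<forall>x\<in>S. \<forall>y\<in>S. x \<noteq> y \<longrightarrow> e \<le> dist x y)"

text \<open>A separated set that is maximal under inclusion is a net.\<close>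

lemma separated_net_exists:
  fixes Y :: "'a::metric_space set"
  assumes "e > 0"
  shows "\<exists>S\<subseteq>Y. separated e S \<and> Y \<subseteq> (\<Union>s\<in>S. ball s e)"
proof -
  let ?\<A> = "{S. S \<subseteq> Y \<and> separated e S}"
  have "\<exists>M\<in>?\<A>. \<forall>S\<in>?\<A>. M \<subseteq> S \<longrightarrow> S = M"
  proof (rule subset_Zorn_nonempty)
    show "?\<A> \<noteq> {}" by (auto simp: separated_def)
    fix \<C> assume ch: "subset.chain ?\<A> \<C>"
    have "e \<le> dist x y" if "x \<in> \<Union>\<C>" "y \<in> \<Union>\<C>" "x \<noteq> y" for x y
    proof -
      obtain A B where AB: "A \<in> \<C>" "B \<in> \<C>" "x \<in> A" "y \<in> B" using \<open>x \<in> _\<close> \<open>y \<in> _\<close> by auto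
      then have "A \<subseteq> B \<or> B \<subseteq> A" using ch unfolding subset.chain_def by blast
      with AB obtain S where "S \<in> \<C>" "x \<in> S" "y \<in> S" by blast
      then show ?thesis
        using ch \<open>x \<noteq> y\<close> unfolding subset.chain_def separated_def by blast
    qed
    then have "separated e (\<Union>\<C>)" unfolding separated_def by simp
    moreover have "\<Union>\<C> \<subseteq> Y" using ch unfolding subset.chain_def by blast
    ultimately show "\<Union>\<C> \<in> ?\<A>" by simp
  qed
  then obtain M where "M \<in> ?\<A>" and max: "\<forall>S\<in>?\<A>. M \<subseteq> S \<longrightarrow> S = M" by (elim bexE)
  then have M: "M \<subseteq> Y" "separated e M" by simp_all
  have "y \<in> (\<Union>s\<in>M. ball s e)" if "y \<in> Y" for y
  proof (rule ccontr)
    assume no: "y \<notin> (\<Union>s\<in>M. ball s e)"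
    then have "separated e (insert y M)"
      using M(2) unfolding separated_def by (auto simp: dist_commute not_less)
    then have "insert y M = M" using M(1) that by (intro max[rule_format]) auto
    then have "y \<in> M" by blast
    then show False using no \<open>e > 0\<close> by auto
  qed
  then show ?thesis using M by blast
qed

lemma finite_compact_Int_separated:
  fixes K :: "'a::metric_space set"
  assumes "compact K" "separated e S" "e > 0"
  shows "finite (K \<inter> S)"
proof -
  obtain k where k: "finite k" "K \<subseteq> (\<Union>x\<in>k. ball x (e/2))"
    using assms compact_eq_totally_bounded[of K] half_gt_zero by blast
  have "finite (ball x (e/2) \<inter> S)" for x
  proof -
    have "u = v" if "u \<in> ball x (e/2) \<inter> S" "v \<in> ball x (e/2) \<inter> S" for u v
    proof (rule ccontr)
      assume "u \<noteq> v"
      then have "e \<le> dist u v" using that assms(2) unfolding separated_def by blast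
      moreover have "dist u v < e"
        using that dist_triangle_half_r[of x u e v] by (simp add: dist_commute)
      ultimately show False by simp
    qed
    then have "ball x (e/2) \<inter> S \<subseteq> {SOME u. u \<in> ball x (e/2) \<inter> S}"
      by (metis (no_types, lifting) insertI1 someI subsetI)
    then show ?thesis using finite_subset by blast
  qed
  then have "finite (\<Union>x\<in>k. ball x (e/2) \<inter> S)" using k(1) by blast
  then show ?thesis by (rule rev_finite_subset) (use k in blast)
qed

text \<open>Take separated nets at the scales \<open>1/(n+1)\<close>; a compact set meets each of them in a finite
  set.\<close>

lemma dense_countable_trace:
  fixes Y :: "'a::metric_space set"
  obtains D where "D \<subseteq> Y" "Y \<subseteq> closure D" "\<And>K. compact K \<Longrightarrow> countable (K \<inter> D)"
proof -
  have "\<exists>S\<subseteq>Y. separated (1 / real (Suc n)) S \<and> Y \<subseteq> (\<Union>s\<in>S. ball s (1 / real (Suc n)))" for n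
    by (intro separated_net_exists) simp
  then obtain S where S: "\<And>n. S n \<subseteq> Y" "\<And>n. separated (1 / real (Suc n)) (S n)"
    "\<And>n. Y \<subseteq> (\<Union>s\<in>S n. ball s (1 / real (Suc n)))" by metis
  show thesis
  proof
    show "(\<Union>n. S n) \<subseteq> Y" using S(1) by blast
    show "Y \<subseteq> closure (\<Union>n. S n)"
    proof
      fix y assume y: "y \<in> Y"
      show "y \<in> closure (\<Union>n. S n)"
        unfolding closure_approachable
      proof (intro allI impI)
        fix e :: real assume "e > 0"
        then obtain n where n: "1 / real (Suc n) < e" by (rule nat_approx_posE)
        obtain s where "s \<in> S n" "dist s y < 1 / real (Suc n)"
          using S(3)[of n] y by auto
        then show "\<exists>s\<in>\<Union>n. S n. dist s y < e" using n by (meson UN_I UNIV_I less_trans)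
      qed
    qed
    fix K :: "'a set" assume "compact K"
    then have "finite (K \<inter> S n)" for n using S(2) by (rule finite_compact_Int_separated) simp
    then have "countable (\<Union>n. K \<inter> S n)" using countable_finite by blast
    then show "countable (K \<inter> (\<Union>n. S n))" by (simp only: Int_UN_distrib)
  qed
qed

lemma infinite_separated_if_not_compact:
  fixes Y :: "'a::metric_space set"
  assumes "complete Y" "\<not> compact Y"
  obtains e a where "e > 0" "inj a" "range a \<subseteq> Y" "separated e (range (a :: nat \<Rightarrow> 'a))"
proof -
  obtain e where e: "e > 0" "\<And>k. finite k \<Longrightarrow> \<not> Y \<subseteq> (\<Union>x\<in>k. ball x e)"
    using assms unfolding compact_eq_totally_bounded by blast
  obtain S where S: "S \<subseteq> Y" "separated e S" "Y \<subseteq> (\<Union>s\<in>S. ball s e)"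
    using separated_net_exists[OF e(1)] by blast
  have "infinite S" using e(2) S(3) by blast
  then obtain a :: "nat \<Rightarrow> 'a" where a: "inj a" "range a \<subseteq> S"
    using infinite_countable_subset by blast
  then have "range a \<subseteq> Y" "separated e (range a)" using S unfolding separated_def by blast+
  then show thesis using that e(1) a(1) by blast
qed

text \<open>A neighborhood of \<open>x\<close> contains all but finitely many of the sets \<open>F n\<close>.\<close>

lemma compact_shrinking_finite_sets:
  fixes x :: "'a::metric_space"
  assumes fin: "\<And>n. finite (F n)" and sub: "\<And>n. F n \<subseteq> cball x (1 / real (Suc n))"
  shows "compact (insert x (\<Union>n. F n))"
proof (rule compactI)
  fix \<U> assume op: "\<forall>B\<in>\<U>. open B" and cov: "insert x (\<Union>n. F n) \<subseteq> \<Union>\<U>"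
  then obtain U where U: "U \<in> \<U>" "x \<in> U" by blast
  then obtain e where e: "e > 0" "ball x e \<subseteq> U" using op open_contains_ball by blast
  then obtain N where N: "1 / real (Suc N) < e" by (meson nat_approx_posE)
  have tail: "F n \<subseteq> U" if "n \<ge> N" for n
  proof -
    have "1 / real (Suc n) \<le> 1 / real (Suc N)" using that by (simp add: frac_le)
    then have "cball x (1 / real (Suc n)) \<subseteq> ball x e" using N by auto
    then show ?thesis using sub e(2) by blast
  qed
  have "compact (\<Union>n<N. F n)" using fin by (intro finite_imp_compact) auto
  then obtain \<D> where \<D>: "\<D> \<subseteq> \<U>" "finite \<D>" "(\<Union>n<N. F n) \<subseteq> \<Union>\<D>"
  proof (rule compactE[of _ \<U>])
    show "(\<Union>n<N. F n) \<subseteq> \<Union>\<U>" using cov by blast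
  qed (use op in auto)
  have "F n \<subseteq> \<Union>(insert U \<D>)" for n
  proof (cases "n < N")
    case True
    then have "F n \<subseteq> (\<Union>n<N. F n)" by blast
    then show ?thesis using \<D>(3) by auto
  next
    case False
    then show ?thesis using tail[of n] by auto
  qed
  then have "insert x (\<Union>n. F n) \<subseteq> \<Union>(insert U \<D>)" using U by blast
  then show "\<exists>C'\<subseteq>\<U>. finite C' \<and> insert x (\<Union>n. F n) \<subseteq> \<Union>C'"
    using \<D> U by (intro exI[of _ "insert U \<D>"]) auto
qed

lemma compact_closure_finite_net:
  fixes K :: "'a::metric_space set"
  assumes "compact K" "K \<subseteq> closure D" "e > 0"
  obtains F where "finite F" "F \<subseteq> D" "K \<subseteq> (\<Union>a\<in>F. ball a e)"
proof -
  have "K \<subseteq> (\<Union>a\<in>D. ball a e)"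
  proof
    fix y assume "y \<in> K"
    then have "y \<in> closure D" using assms(2) by blast
    then obtain a where "a \<in> D" "dist a y < e"
      using assms(3) unfolding closure_approachable by blast
    then show "y \<in> (\<Union>a\<in>D. ball a e)" by auto
  qed
  then show thesis
    using compactE_image[of K D "\<lambda>a. ball a e"] assms(1) that open_ball by metis
qed

lemma compact_closure_countable_subset:
  fixes K :: "'a::metric_space set"
  assumes "compact K" "K \<subseteq> closure D"
  obtains A where "countable A" "A \<subseteq> D" "K \<subseteq> closure A"
proof -
  have "\<exists>F. finite F \<and> F \<subseteq> D \<and> K \<subseteq> (\<Union>a\<in>F. ball a (1 / real (Suc n)))" for n
    by (rule compact_closure_finite_net[OF assms, of "1 / real (Suc n)"]) auto
  then obtain F where F: "\<And>n. finite (F n)" "\<And>n. F n \<subseteq> D"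
    "\<And>n. K \<subseteq> (\<Union>a\<in>F n. ball a (1 / real (Suc n)))" by metis
  show thesis
  proof
    show "countable (\<Union>n. F n)" using F(1) countable_finite by blast
    show "(\<Union>n. F n) \<subseteq> D" using F(2) by blast
    show "K \<subseteq> closure (\<Union>n. F n)"
    proof
      fix y assume y: "y \<in> K"
      show "y \<in> closure (\<Union>n. F n)"
        unfolding closure_approachable
      proof (intro allI impI)
        fix e :: real assume "e > 0"
        then obtain n where n: "1 / real (Suc n) < e" by (rule nat_approx_posE)
        obtain s where "s \<in> F n" "dist s y < 1 / real (Suc n)"
          using F(3)[of n] y by auto
        then show "\<exists>s\<in>\<Union>n. F n. dist s y < e" using n by (meson UN_I UNIV_I less_trans)
      qed
    qed
  qed
qed

section \<open>Upper bounds for the cofinality of the compact sets\<close>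

text \<open>
  Total boundedness made explicit: \<open>f n\<close> prescribes how many terms of \<open>a\<close> may serve as centres
  at the scale \<open>1/(n+1)\<close>. If \<open>a\<close> is dense, these sets dominate all compact sets, and they grow with
  \<open>f\<close>; so compact sets in a separable complete space are governed by functions from \<open>\<nat>\<close>
  to \<open>\<nat>\<close>.
\<close>

definition box_of_balls :: "'a::metric_space set \<Rightarrow> (nat \<Rightarrow> 'a) \<Rightarrow> (nat \<Rightarrow> nat) \<Rightarrow> 'a set" where
  "box_of_balls X a f = X \<inter> (\<Inter>n. \<Union>i\<le>f n. cball (a i) (1 / real (Suc n)))"

lemma compact_box_of_balls:
  assumes "complete X"
  shows "compact (box_of_balls X a f)"
  unfolding compact_eq_totally_bounded
proof (intro conjI allI impI)
  show "complete (box_of_balls X a f)"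
    unfolding box_of_balls_def using assms by (intro complete_Int_closed closed_INT) auto
  fix e :: real assume "e > 0"
  then obtain n where n: "1 / real (Suc n) < e" by (rule nat_approx_posE)
  have "cball (a i) (1 / real (Suc n)) \<subseteq> ball (a i) e" for i using n by auto
  then have "box_of_balls X a f \<subseteq> (\<Union>x\<in>a ` {..f n}. ball x e)"
    unfolding box_of_balls_def by blast
  then show "\<exists>k. finite k \<and> box_of_balls X a f \<subseteq> (\<Union>x\<in>k. ball x e)" by blast
qed

lemma box_of_balls_mono: "f \<le> g \<Longrightarrow> box_of_balls X a f \<subseteq> box_of_balls X a g"
  unfolding box_of_balls_def le_fun_def by (fastforce intro: order_trans)

lemma compact_subset_box_of_balls:
  assumes "compact K" "K \<subseteq> X" "K \<subseteq> closure (range a)"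
  obtains f where "K \<subseteq> box_of_balls X a f"
proof -
  have "\<exists>m. K \<subseteq> (\<Union>i\<le>m. cball (a i) (1 / real (Suc n)))" for n
  proof -
    obtain F where F: "finite F" "F \<subseteq> range a" "K \<subseteq> (\<Union>c\<in>F. ball c (1 / real (Suc n)))"
      using compact_closure_finite_net[OF assms(1,3), of "1 / real (Suc n)"] by auto
    then obtain I where I: "finite I" "F = a ` I" by (meson finite_subset_image)
    then have "I \<subseteq> {..Max I}" by auto
    moreover have "ball (a i) r \<subseteq> cball (a i) r" for i r by auto
    ultimately have "K \<subseteq> (\<Union>i\<le>Max I. cball (a i) (1 / real (Suc n)))" using F(3) I(2) by blast
    then show ?thesis by blast
  qed
  then obtain f where "\<And>n. K \<subseteq> (\<Union>i\<le>f n. cball (a i) (1 / real (Suc n)))" by metis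
  then have "K \<subseteq> box_of_balls X a f" using assms(2) unfolding box_of_balls_def by blast
  then show thesis by (rule that)
qed

text \<open>
  The local families are indexed by a dense set and the radii \<open>1/(n+1)\<close> rather than by the points
  of the space, which keeps their number at the density. Every compact set is covered by finitely
  many of the chosen balls, hence is a finite union of compact pieces that are dominated locally.
\<close>

lemma cof_compacts_le_local:
  fixes X :: "'a::metric_space set" and \<mu> :: "'b rel"
  assumes \<mu>: "cinfinite \<mu>" "Card_order \<mu>" and dens: "dense_char X \<le>o \<mu>"
    and loc: "\<And>x. x \<in> X \<Longrightarrow> \<exists>e>0. \<exists>\<G>. |\<G>| \<le>o \<mu> \<and> \<G> \<subseteq> compacts X \<and>
      (\<forall>K. compact K \<and> K \<subseteq> cball x e \<inter> X \<longrightarrow> (\<exists>G\<in>\<G>. K \<subseteq> G))"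
  shows "cof (compacts X) (\<subseteq>) \<le>o \<mu>"
proof -
  obtain D where D: "D \<subseteq> X" "X \<subseteq> closure D" "dense_char X = |D|"
    using dense_char_attained[of X] by blast
  define good where "good p \<G> \<longleftrightarrow> |\<G>| \<le>o \<mu> \<and> \<G> \<subseteq> compacts X \<and>
      (\<forall>K. compact K \<and> K \<subseteq> cball (fst p) (1 / real (Suc (snd p))) \<inter> X \<longrightarrow> (\<exists>G\<in>\<G>. K \<subseteq> G))"
    for p :: "'a \<times> nat" and \<G> :: "'a set set"
  define J where "J = {p \<in> D \<times> UNIV. \<exists>\<G>. good p \<G>}"
  have "\<forall>p\<in>J. \<exists>\<G>. good p \<G>" unfolding J_def by simp
  then obtain g where "\<forall>p\<in>J. good p (g p)" using bchoice[of J good] by auto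
  then have g: "\<And>p. p \<in> J \<Longrightarrow> good p (g p)" by (rule bspec)
  define H where "H = (\<Union>p\<in>J. g p)"
  have "|D \<times> (UNIV :: nat set)| \<le>o \<mu>"
    using dens D(3) by (intro card_of_Times_ordLeq countable_card_of_ordLeq[of UNIV] \<mu>) auto
  then have "|J| \<le>o \<mu>"
    using card_of_mono1[of J "D \<times> UNIV"] ordLeq_transitive unfolding J_def by blast
  then have "|H| \<le>o \<mu>"
    unfolding H_def by (rule card_of_Union_image_ordLeq[OF \<mu>]) (use g good_def in blast)
  then have card: "|Union ` {F. finite F \<and> F \<subseteq> H}| \<le>o \<mu>"
    by (intro card_of_image_ordLeq card_of_finite_subsets_ordLeq \<mu>)
  have H: "H \<subseteq> compacts X" using g unfolding H_def good_def by blast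
  have cover: "\<exists>p\<in>J. y \<in> ball (fst p) (1 / real (Suc (snd p)))" if y: "y \<in> X" for y
  proof -
    obtain e \<G> where e: "e > 0" and \<G>: "|\<G>| \<le>o \<mu>" "\<G> \<subseteq> compacts X"
      "\<forall>K. compact K \<and> K \<subseteq> cball y e \<inter> X \<longrightarrow> (\<exists>G\<in>\<G>. K \<subseteq> G)"
      using loc[OF y] by (elim exE conjE)
    obtain n where n: "1 / real (Suc n) < e / 2" using e by (meson half_gt_zero nat_approx_posE)
    have "y \<in> closure D" using D(2) y by blast
    then obtain d where d: "d \<in> D" "dist d y < 1 / real (Suc n)"
      unfolding closure_approachable by (metis of_nat_0_less_iff zero_less_Suc zero_less_divide_1_iff)
    have "cball d (1 / real (Suc n)) \<subseteq> cball y e"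
    proof
      fix z assume "z \<in> cball d (1 / real (Suc n))"
      then have "dist d z < e / 2" "dist d y < e / 2" using n d(2) by auto
      then have "dist y z < e" using dist_triangle_half_r by blast
      then show "z \<in> cball y e" by simp
    qed
    then have "K \<subseteq> cball y e \<inter> X" if "K \<subseteq> cball d (1 / real (Suc n)) \<inter> X" for K
      using that by blast
    then have "good (d, n) \<G>" using \<G> unfolding good_def by simp
    then have "(d, n) \<in> J" using d(1) unfolding J_def by blast
    then show ?thesis using d(2) by force
  qed
  have "cofinal_in (compacts X) (\<subseteq>) (Union ` {F. finite F \<and> F \<subseteq> H})"
    unfolding cofinal_in_def
  proof (intro conjI ballI)
    show "Union ` {F. finite F \<and> F \<subseteq> H} \<subseteq> compacts X"
      using H by (auto simp: compacts_def subset_iff intro!: compact_Union)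
    fix K assume "K \<in> compacts X"
    then have K: "compact K" "K \<subseteq> X" by (auto simp: compacts_def)
    have KJ: "K \<subseteq> (\<Union>p\<in>J. ball (fst p) (1 / real (Suc (snd p))))" using K(2) cover by blast
    obtain J' where J': "J' \<subseteq> J" "finite J'"
      "K \<subseteq> (\<Union>p\<in>J'. ball (fst p) (1 / real (Suc (snd p))))"
      by (rule compactE_image[OF K(1) open_ball KJ])
    let ?B = "\<lambda>p. cball (fst p) (1 / real (Suc (snd p)))"
    have "\<exists>G\<in>g p. K \<inter> ?B p \<subseteq> G" if "p \<in> J'" for p
    proof -
      have "good p (g p)" using g J'(1) that by blast
      moreover have "compact (K \<inter> ?B p)" using K(1) by (rule compact_Int_closed) simp
      moreover have "K \<inter> ?B p \<subseteq> ?B p \<inter> X" using K(2) by blast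
      ultimately show ?thesis unfolding good_def by blast
    qed
    then obtain G where G: "\<And>p. p \<in> J' \<Longrightarrow> G p \<in> g p" "\<And>p. p \<in> J' \<Longrightarrow> K \<inter> ?B p \<subseteq> G p"
      by metis
    have "K \<subseteq> \<Union>(G ` J')"
    proof
      fix y assume y: "y \<in> K"
      then obtain p where p: "p \<in> J'" "y \<in> ball (fst p) (1 / real (Suc (snd p)))"
        using J'(3) by (meson UN_E subsetD)
      then have "y \<in> K \<inter> ?B p" using y by simp
      then show "y \<in> \<Union>(G ` J')" using G(2)[OF p(1)] p(1) by (meson UN_I subsetD)
    qed
    moreover have "finite (G ` J')" "G ` J' \<subseteq> H" using G(1) J' unfolding H_def by auto
    ultimately show "\<exists>c\<in>Union ` {F. finite F \<and> F \<subseteq> H}. K \<subseteq> c" by blast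
  qed
  then have "cof (compacts X) (\<subseteq>) \<le>o |Union ` {F. finite F \<and> F \<subseteq> H}|"
    by (intro cof_least) auto
  then show ?thesis using card by (rule ordLeq_transitive)
qed

text \<open>
  Compact subsets of \<open>closure D\<close> are dominated by the boxes whose sequence enumerates a member of a
  cofinal family of countable subsets of \<open>D\<close> and whose bounds come from a dominating family.
  If \<open>D\<close> is finite there are no countably infinite subsets, but then \<open>D\<close> is its own closure.
\<close>

lemma local_dominating_family:
  fixes X :: "'a::metric_space set" and \<mu> :: "'b rel"
  assumes X: "complete X" and \<mu>: "cinfinite \<mu>" "Card_order \<mu>"
    and dom: "dominating_number \<le>o \<mu>"
    and ctbl: "cof (ctbl_infinite_subsets |D| ) (\<subseteq>) \<le>o \<mu>" and D: "D \<subseteq> X"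
  obtains \<G> where "|\<G>| \<le>o \<mu>" "\<G> \<subseteq> compacts X"
    "\<And>K. compact K \<Longrightarrow> K \<subseteq> X \<Longrightarrow> K \<subseteq> closure D \<Longrightarrow> \<exists>G\<in>\<G>. K \<subseteq> G"
proof (cases "finite D")
  case True
  show thesis
  proof
    show "|{D}| \<le>o \<mu>" by (intro countable_card_of_ordLeq \<mu>) auto
    show "{D} \<subseteq> compacts X" using True D by (auto simp: compacts_def finite_imp_compact)
    show "\<exists>G\<in>{D}. K \<subseteq> G" if "K \<subseteq> closure D" for K
      using that True by (simp add: finite_imp_closed closure_closed)
  qed
next
  case False
  obtain \<A> where \<A>: "cofinal_in (ctbl_infinite_subsets |D| ) (\<subseteq>) \<A>" "|\<A>| \<le>o \<mu>"
    using cof_attained[of "ctbl_infinite_subsets |D|" "(\<subseteq>)"] ctbl by auto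
  obtain F :: "(nat \<Rightarrow> nat) set" where F: "cofinal_in UNIV (\<le>) F" "|F| \<le>o \<mu>"
    using cof_attained[of "UNIV :: (nat \<Rightarrow> nat) set" "(\<le>)"] dom
    unfolding dominating_number_def by auto
  let ?\<G> = "(\<lambda>(A, f). box_of_balls X (from_nat_into A) f) ` (\<A> \<times> F)"
  show thesis
  proof
    show "|?\<G>| \<le>o \<mu>" using \<A> F by (intro card_of_image_ordLeq card_of_Times_ordLeq \<mu>)
    show "?\<G> \<subseteq> compacts X"
      using compact_box_of_balls[OF X] by (auto simp: compacts_def box_of_balls_def)
    fix K assume K: "compact K" "K \<subseteq> X" "K \<subseteq> closure D"
    obtain A0 where A0: "countable A0" "A0 \<subseteq> D" "K \<subseteq> closure A0"
      using compact_closure_countable_subset[OF K(1,3)] by blast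
    obtain A1 where A1: "countable A1" "A1 \<subseteq> D" "infinite A1"
      using infinite_countable_subset'[OF False] by blast
    have "A0 \<union> A1 \<in> ctbl_infinite_subsets |D|"
      using A0 A1 by (auto simp: ctbl_infinite_subsets_def Field_card_of)
    then obtain A where A: "A \<in> \<A>" "A0 \<union> A1 \<subseteq> A" using \<A>(1) unfolding cofinal_in_def by blast
    then have "A \<in> ctbl_infinite_subsets |D|" using \<A>(1) unfolding cofinal_in_def by blast
    then have "range (from_nat_into A) = A"
      by (intro range_from_nat_into) (auto simp: ctbl_infinite_subsets_def)
    then have "K \<subseteq> closure (range (from_nat_into A))"
      using A0(3) A(2) closure_mono[of A0 A] by auto
    then obtain f where f: "K \<subseteq> box_of_balls X (from_nat_into A) f"
      using compact_subset_box_of_balls K(1,2) by blast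
    obtain h where "h \<in> F" "f \<le> h" using F(1) unfolding cofinal_in_def by blast
    then show "\<exists>G\<in>?\<G>. K \<subseteq> G"
      using f box_of_balls_mono[of f h X "from_nat_into A"] A(1) by fastforce
  qed
qed

section \<open>Lower bounds for the cofinality of the compact sets\<close>

lemma infinite_cofinal_compacts:
  assumes "\<not> compact X" "cofinal_in (compacts X) (\<subseteq>) C"
  shows "infinite C"
proof
  assume "finite C"
  then have "compact (\<Union>C)"
    using assms(2) by (intro compact_Union) (auto simp: cofinal_in_def compacts_def)
  moreover have "\<Union>C = X"
  proof
    show "\<Union>C \<subseteq> X" using assms(2) by (auto simp: cofinal_in_def compacts_def)
    show "X \<subseteq> \<Union>C"
    proof
      fix x assume "x \<in> X"
      then have "{x} \<in> compacts X" by (simp add: compacts_def)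
      then show "x \<in> \<Union>C" using assms(2) unfolding cofinal_in_def by blast
    qed
  qed
  ultimately show False using assms(1) by simp
qed

text \<open>
  A cofinal family of compact sets covers \<open>X\<close>, and each of its members contributes only countably
  many points to a suitable dense set.
\<close>

lemma dense_char_le_cofinal_compacts:
  fixes X :: "'a::metric_space set"
  assumes "\<not> compact X" and C: "cofinal_in (compacts X) (\<subseteq>) C"
  shows "dense_char X \<le>o |C|"
proof -
  have inf: "cinfinite |C|"
    using infinite_cofinal_compacts[OF assms] by (simp add: cinfinite_card_of_iff)
  obtain D where D: "D \<subseteq> X" "X \<subseteq> closure D" "\<And>K. compact K \<Longrightarrow> countable (K \<inter> D)"
    using dense_countable_trace[of X] by blast
  have "|\<Union>K\<in>C. K \<inter> D| \<le>o |C|"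
  proof (rule card_of_Union_image_ordLeq[OF inf])
    show "|K \<inter> D| \<le>o |C|" if "K \<in> C" for K
      using that C D(3) inf
      by (intro countable_card_of_ordLeq)
        (auto simp: cofinal_in_def compacts_def card_of_Card_order)
  qed (auto simp: card_of_Card_order ordLeq_refl)
  moreover have "D \<subseteq> (\<Union>K\<in>C. K \<inter> D)"
  proof
    fix d assume d: "d \<in> D"
    then have "{d} \<in> compacts X" using D(1) by (auto simp: compacts_def)
    then show "d \<in> (\<Union>K\<in>C. K \<inter> D)" using C d unfolding cofinal_in_def by blast
  qed
  ultimately have "|D| \<le>o |C|" using card_of_mono1 ordLeq_transitive by blast
  then show ?thesis using dense_char_least[OF D(1,2)] ordLeq_transitive by blast
qed

text \<open>
  A function \<open>f\<close> is coded by the compact set consisting of \<open>x\<close> and the first \<open>f n + 1\<close> points of the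
  \<open>n\<close>-th separated sequence. Conversely, a compact set contains finitely many points of each
  sequence, so it has a function bounding all the functions coded inside it.
\<close>

lemma dominating_number_le_cofinal_compacts:
  fixes X :: "'a::metric_space set"
  assumes X: "complete X" and x: "x \<in> X" and nc: "\<And>e. e > 0 \<Longrightarrow> \<not> compact (cball x e \<inter> X)"
    and C: "cofinal_in (compacts X) (\<subseteq>) C"
  shows "dominating_number \<le>o |C|"
proof -
  have "\<exists>e a. e > 0 \<and> inj a \<and> range a \<subseteq> cball x (1 / real (Suc n)) \<inter> X \<and>
      separated e (range (a :: nat \<Rightarrow> 'a))" for n
  proof -
    have "complete (cball x (1 / real (Suc n)) \<inter> X)"
      using X by (simp add: Int_commute complete_Int_closed)
    moreover have "\<not> compact (cball x (1 / real (Suc n)) \<inter> X)" by (rule nc) simp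
    ultimately show ?thesis by (rule infinite_separated_if_not_compact) blast
  qed
  then obtain e a where e: "\<And>n. e n > (0::real)" and inj: "\<And>n :: nat. inj (a n)"
    and ran: "\<And>n. range (a n) \<subseteq> cball x (1 / real (Suc n)) \<inter> X"
    and sep: "\<And>n. separated (e n) (range (a n :: nat \<Rightarrow> 'a))" by metis
  have "\<exists>b. \<forall>m. a n m \<in> K \<longrightarrow> m \<le> b" if "K \<in> C" for K n
  proof -
    have "compact K" using that C by (auto simp: cofinal_in_def compacts_def)
    then have "finite (K \<inter> range (a n))" using sep e by (rule finite_compact_Int_separated)
    then have "finite (a n -` (K \<inter> range (a n)))" using inj by (rule finite_vimageI)
    then show ?thesis
      by (metis (no_types, lifting) IntI finite_nat_set_iff_bounded_le rangeI vimageI)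
  qed
  then obtain b where b: "\<And>K n m. K \<in> C \<Longrightarrow> a n m \<in> K \<Longrightarrow> m \<le> b K n" by metis
  have "cofinal_in UNIV (\<le>) (b ` C)"
    unfolding cofinal_in_def
  proof (intro conjI ballI)
    fix f :: "nat \<Rightarrow> nat"
    let ?K = "insert x (\<Union>n. a n ` {..f n})"
    have "compact ?K" using ran by (intro compact_shrinking_finite_sets) auto
    moreover have "?K \<subseteq> X" using ran x by blast
    ultimately obtain K where K: "K \<in> C" "?K \<subseteq> K"
      using C unfolding cofinal_in_def compacts_def by blast
    then have "f n \<le> b K n" for n by (intro b) auto
    then show "\<exists>c\<in>b ` C. f \<le> c" using K(1) by (auto simp: le_fun_def)
  qed simp
  then have "dominating_number \<le>o |b ` C|"
    unfolding dominating_number_def by (intro cof_least) auto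
  then show ?thesis using card_of_image ordLeq_transitive by blast
qed

text \<open>
  Let \<open>D\<close> be a set whose size is the local density at \<open>x\<close>. Every ball about \<open>x\<close> has density at
  least \<open>|D|\<close>. Hence, if \<open>D\<close> is infinite, in the ball
  of radius \<open>1/(n+1)\<close> a dense set with countable compact traces maps onto \<open>D\<close>, and the images of the
  traces of a compact set form a countable subset of \<open>D\<close>. All countable subsets are
  covered in this way: their \<open>n\<close>-th element has a preimage in the \<open>n\<close>-th ball, and these preimages
  converge to \<open>x\<close>. Having such a surjection for every \<open>n\<close> is what makes it unnecessary to find
  separated sets of full size, which need not exist when the local density has countable cofinality.
\<close>

lemma cof_ctbl_infinite_subsets_le_cofinal_compacts:
  fixes X :: "'a::metric_space set"
  assumes x: "x \<in> X" and C: "cofinal_in (compacts X) (\<subseteq>) C"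
  shows "cof (ctbl_infinite_subsets (local_density X x)) (\<subseteq>) \<le>o |C|"
proof -
  obtain N D where D: "D \<subseteq> N" "N \<subseteq> closure D" "local_density X x = |D|"
    using local_density_attained[OF x] by blast
  let ?P = "ctbl_infinite_subsets |D|"
  show ?thesis
  proof (cases "finite D")
    case True
    then have "?P = {}"
      by (auto simp: ctbl_infinite_subsets_def Field_card_of dest: finite_subset)
    then have "cof ?P (\<subseteq>) \<le>o |{} :: 'a set set|" by (intro cof_least) (auto simp: cofinal_in_def)
    then show ?thesis using D(3) card_of_empty ordLeq_transitive by metis
  next
    case False
    have "\<exists>E g. E \<subseteq> cball x (1 / real (Suc n)) \<inter> X \<and> (\<forall>K. compact K \<longrightarrow> countable (K \<inter> E)) \<and>
        g ` E = D" for n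
    proof -
      let ?B = "cball x (1 / real (Suc n)) \<inter> X"
      obtain E where E: "E \<subseteq> ?B" "?B \<subseteq> closure E" "\<And>K. compact K \<Longrightarrow> countable (K \<inter> E)"
        using dense_countable_trace[of ?B] by blast
      have "openin (top_of_set X) (X \<inter> ball x (1 / real (Suc n)))"
        by (intro openin_open_Int) simp
      then have "nbhd_in X x ?B"
        using x unfolding nbhd_in_def
        by (intro conjI exI[of _ "X \<inter> ball x (1 / real (Suc n))"]) auto
      then have "|D| \<le>o |E|" using local_density_least[OF x _ E(1,2)] D(3) by simp
      moreover have "D \<noteq> {}" using False by auto
      ultimately obtain g where "g ` E = D" using card_of_ordLeq2 by metis
      then show ?thesis using E by blast
    qed
    then obtain E g where E: "\<And>n. E n \<subseteq> cball x (1 / real (Suc n)) \<inter> X"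
      "\<And>n K. compact K \<Longrightarrow> countable (K \<inter> E n)" "\<And>n. g n ` E n = D" by metis
    obtain A1 where A1: "countable A1" "A1 \<subseteq> D" "infinite A1"
      using infinite_countable_subset'[OF False] by blast
    \<comment> \<open>A compact set may have a finite trace; adding \<open>A1\<close> keeps the values infinite.\<close>
    define \<phi> where "\<phi> K = A1 \<union> (\<Union>n. g n ` (K \<inter> E n))" for K
    have "cofinal_in ?P (\<subseteq>) (\<phi> ` C)"
      unfolding cofinal_in_def
    proof (intro conjI ballI)
      show "\<phi> ` C \<subseteq> ?P"
      proof
        fix A assume "A \<in> \<phi> ` C"
        then obtain K where K: "K \<in> C" "A = \<phi> K" by blast
        then have "compact K" using C by (auto simp: cofinal_in_def compacts_def)
        then have "countable A" unfolding K(2) \<phi>_def using A1(1) E(2) by auto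
        moreover have "infinite A" unfolding K(2) \<phi>_def using A1(3) by simp
        moreover have "A \<subseteq> D" unfolding K(2) \<phi>_def using A1(2) E(3) by blast
        ultimately show "A \<in> ?P" by (simp add: ctbl_infinite_subsets_def Field_card_of)
      qed
      fix A assume "A \<in> ?P"
      then have A: "A \<subseteq> D" "countable A" "infinite A"
        by (auto simp: ctbl_infinite_subsets_def Field_card_of)
      then have "A \<noteq> {}" by auto
      then have ran: "range (from_nat_into A) = A" using A(2) by (rule range_from_nat_into)
      have "\<exists>d\<in>E n. g n d = from_nat_into A n" for n
      proof -
        have "from_nat_into A n \<in> g n ` E n" using A(1) E(3) ran by blast
        then show ?thesis by auto
      qed
      then obtain d where d: "\<And>n. d n \<in> E n" "\<And>n. g n (d n) = from_nat_into A n" by metis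
      let ?K = "insert x (\<Union>n. {d n})"
      have "compact ?K" using d(1) E(1) by (intro compact_shrinking_finite_sets) blast+
      moreover have "?K \<subseteq> X" using d(1) E(1) x by blast
      ultimately obtain K where K: "K \<in> C" "?K \<subseteq> K"
        using C unfolding cofinal_in_def compacts_def by blast
      have "from_nat_into A n \<in> \<phi> K" for n
      proof -
        have "d n \<in> K \<inter> E n" using K(2) d(1) by blast
        then have "g n (d n) \<in> \<phi> K" unfolding \<phi>_def by blast
        then show ?thesis using d(2) by simp
      qed
      then have "range (from_nat_into A) \<subseteq> \<phi> K" by (rule image_subsetI)
      then have "A \<subseteq> \<phi> K" using ran by simp
      then show "\<exists>c\<in>\<phi> ` C. A \<subseteq> c" using K(1) by blast
    qed
    then have "cof ?P (\<subseteq>) \<le>o |\<phi> ` C|" by (intro cof_least) auto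
    then show ?thesis using D(3) card_of_image ordLeq_transitive by metis
  qed
qed

section \<open>The cofinality of the compact sets\<close>

lemma infinite_if_not_compact_closure:
  assumes "\<not> compact X" "D \<subseteq> X" "X \<subseteq> closure D"
  shows "infinite (D :: 'a::metric_space set)"
proof
  assume "finite D"
  then have "X = D" using assms(2,3) by (simp add: finite_imp_closed closure_closed)
  then show False using assms(1) \<open>finite D\<close> finite_imp_compact by blast
qed

lemma cinfinite_dense_char:
  fixes X :: "'a::metric_space set"
  assumes "\<not> compact X"
  shows "Cinfinite (dense_char X)"
  using dense_char_attained[of X] infinite_if_not_compact_closure[OF assms]
  by (metis card_of_Card_order cinfinite_card_of_iff)

lemma locally_compact_cball:
  fixes X :: "'a::metric_space set"
  shows "locally compact X \<longleftrightarrow> (\<forall>x\<in>X. \<exists>e>0. compact (cball x e \<inter> X))"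
proof
  assume lc: "locally compact X"
  show "\<forall>x\<in>X. \<exists>e>0. compact (cball x e \<inter> X)"
  proof
    fix x assume "x \<in> X"
    then obtain u v where uv: "x \<in> u" "u \<subseteq> v" "v \<subseteq> X" "openin (top_of_set X) u" "compact v"
      using lc unfolding locally_compact by metis
    then obtain e where e: "e > 0" "cball x e \<inter> X \<subseteq> u" unfolding openin_contains_cball by blast
    then have "cball x e \<inter> X = v \<inter> cball x e" using uv by blast
    then show "\<exists>e>0. compact (cball x e \<inter> X)" using e(1) uv(5) compact_Int_closed by fastforce
  qed
next
  assume R: "\<forall>x\<in>X. \<exists>e>0. compact (cball x e \<inter> X)"
  show "locally compact X"
    unfolding locally_compact
  proof
    fix x assume x: "x \<in> X"
    then obtain e where e: "e > 0" "compact (cball x e \<inter> X)" using R by blast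
    have "openin (top_of_set X) (X \<inter> ball x e)" by (intro openin_open_Int) simp
    moreover have "X \<inter> ball x e \<subseteq> cball x e \<inter> X" by auto
    ultimately show "\<exists>u v. x \<in> u \<and> u \<subseteq> v \<and> v \<subseteq> X \<and> openin (top_of_set X) u \<and> compact v"
      using e x by (intro exI[of _ "X \<inter> ball x e"] exI[of _ "cball x e \<inter> X"]) auto
  qed
qed

lemma cof_compacts_locally_compact:
  fixes X :: "'a::metric_space set"
  assumes nc: "\<not> compact X" and lc: "locally compact X"
  shows "cof (compacts X) (\<subseteq>) =o dense_char X"
proof -
  have inf: "Cinfinite (dense_char X)" using nc by (rule cinfinite_dense_char)
  have "cof (compacts X) (\<subseteq>) \<le>o dense_char X"
  proof (rule cof_compacts_le_local)
    show "dense_char X \<le>o dense_char X" using inf by (simp add: ordLeq_refl)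
    fix x assume "x \<in> X"
    then obtain e where e: "e > 0" "compact (cball x e \<inter> X)"
      using lc locally_compact_cball by blast
    moreover have "|{cball x e \<inter> X}| \<le>o dense_char X"
      using inf by (intro countable_card_of_ordLeq) auto
    ultimately show "\<exists>e>0. \<exists>\<G>. |\<G>| \<le>o dense_char X \<and> \<G> \<subseteq> compacts X \<and>
        (\<forall>K. compact K \<and> K \<subseteq> cball x e \<inter> X \<longrightarrow> (\<exists>G\<in>\<G>. K \<subseteq> G))"
      by (intro exI[of _ e] conjI exI[of _ "{cball x e \<inter> X}"]) (auto simp: compacts_def)
  qed (use inf in auto)
  moreover obtain C where "cofinal_in (compacts X) (\<subseteq>) C" "cof (compacts X) (\<subseteq>) = |C|"
    using cof_attained[of "compacts X" "(\<subseteq>)"] by auto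
  then have "dense_char X \<le>o cof (compacts X) (\<subseteq>)"
    using dense_char_le_cofinal_compacts[OF nc] by simp
  ultimately show ?thesis by (simp add: ordIso_iff_ordLeq)
qed

lemma ordLeq_cprod_left: "Card_order r1 \<Longrightarrow> Cnotzero r2 \<Longrightarrow> r1 \<le>o r1 *c r2"
  unfolding cprod_def by (intro Card_order_Times1 Cnotzero_imp_not_empty)

lemma Cnotzero_card_of: "A \<noteq> {} \<Longrightarrow> Cnotzero |A|"
  by (simp add: card_of_Card_order card_of_ordIso_czero_iff_empty)

text \<open>
  All three factors are nonzero, so each of them is below the product. For the supremum this holds
  because at a point without compact balls the local density is infinite.
\<close>

lemma cof_compacts_not_locally_compact:
  fixes X :: "'a::metric_space set"
  assumes X: "complete X" and nlc: "\<not> locally compact X"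
  shows "cof (compacts X) (\<subseteq>) =o
    dense_char X *c dominating_number *c
      sup_card X (\<lambda>x. cof (ctbl_infinite_subsets (local_density X x)) (\<subseteq>))"
proof -
  let ?F = "\<lambda>x. cof (ctbl_infinite_subsets (local_density X x)) (\<subseteq>)"
  let ?s = "sup_card X ?F"
  let ?\<mu> = "dense_char X *c dominating_number *c ?s"
  obtain x0 where x0: "x0 \<in> X" "\<And>e. e > 0 \<Longrightarrow> \<not> compact (cball x0 e \<inter> X)"
    using nlc locally_compact_cball by blast
  have nc: "\<not> compact X"
  proof
    assume "compact X"
    then have "compact (X \<inter> cball x0 1)" by (rule compact_Int_closed) simp
    then show False using x0(2)[of 1] by (simp add: Int_commute)
  qed
  have F: "Card_order (?F x)" for x by (intro Card_order_cof) simp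
  have s: "Card_order ?s" "\<And>x. x \<in> X \<Longrightarrow> ?F x \<le>o ?s"
    by (rule sup_card_Card_order sup_card_upper, rule F, assumption?)+
  have dom: "Card_order dominating_number"
    unfolding dominating_number_def by (intro Card_order_cof) simp
  have d: "Cinfinite (dense_char X)" using nc by (rule cinfinite_dense_char)

  have dom0: "Cnotzero dominating_number"
  proof -
    obtain F where F: "cofinal_in (UNIV :: (nat \<Rightarrow> nat) set) (\<le>) F" "dominating_number = |F|"
      using cof_attained[of "UNIV :: (nat \<Rightarrow> nat) set" "(\<le>)"]
      unfolding dominating_number_def by auto
    then have "F \<noteq> {}" unfolding cofinal_in_def by blast
    then show ?thesis using F(2) Cnotzero_card_of by metis
  qed
  have s0: "Cnotzero ?s"
  proof -
    obtain N D where D: "nbhd_in X x0 N" "D \<subseteq> N" "N \<subseteq> closure D" "local_density X x0 = |D|"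
      using local_density_attained[OF x0(1)] by blast
    then obtain U where U: "openin (top_of_set X) U" "x0 \<in> U" "U \<subseteq> N" "N \<subseteq> X"
      unfolding nbhd_in_def by blast
    then obtain e where e: "e > 0" "cball x0 e \<inter> X \<subseteq> U" unfolding openin_contains_cball by blast
    have "infinite D"
    proof
      assume "finite D"
      then have "cball x0 e \<inter> X \<subseteq> D"
        using e U D by (simp add: finite_imp_closed closure_closed)
      then have "finite (cball x0 e \<inter> X)" using \<open>finite D\<close> finite_subset by blast
      then show False using x0(2)[OF e(1)] finite_imp_compact by blast
    qed
    then obtain A where A: "countable A" "A \<subseteq> D" "infinite A"
      using infinite_countable_subset' by blast
    then have "A \<in> ctbl_infinite_subsets (local_density X x0)"
      using D(4) by (simp add: ctbl_infinite_subsets_def Field_card_of)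
    moreover obtain C where C: "cofinal_in (ctbl_infinite_subsets (local_density X x0)) (\<subseteq>) C"
      "?F x0 = |C|"
      using cof_attained[of "ctbl_infinite_subsets (local_density X x0)" "(\<subseteq>)"] by auto
    ultimately have "C \<noteq> {}" unfolding cofinal_in_def by blast
    then have "Cnotzero (?F x0)" using C(2) Cnotzero_card_of by metis
    then show ?thesis using s(2)[OF x0(1)] s(1) Cnotzero_mono by blast
  qed
  have ds0: "Cnotzero (dominating_number *c ?s)"
    using ordLeq_cprod2[OF dom0 s(1)] s0 Card_order_cprod Cnotzero_mono by blast
  have d0: "Cnotzero (dense_char X)" using d by (rule Cinfinite_Cnotzero)
  have d_le: "dense_char X \<le>o ?\<mu>" using d by (intro ordLeq_cprod_left ds0) simp
  have ds_le: "dominating_number *c ?s \<le>o ?\<mu>"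
    by (rule ordLeq_cprod2[OF d0 Card_order_cprod])
  have dom_le: "dominating_number \<le>o ?\<mu>"
    using ordLeq_cprod_left[OF dom s0] ds_le by (rule ordLeq_transitive)
  have s_le: "?s \<le>o ?\<mu>" using ordLeq_cprod2[OF dom0 s(1)] ds_le by (rule ordLeq_transitive)
  have \<mu>: "cinfinite ?\<mu>" "Card_order ?\<mu>"
    using cinfinite_mono[OF d_le] d by (simp_all add: Card_order_cprod)

  have "cof (compacts X) (\<subseteq>) \<le>o ?\<mu>"
  proof (rule cof_compacts_le_local[OF \<mu> d_le])
    fix x assume x: "x \<in> X"
    obtain N D where D: "nbhd_in X x N" "D \<subseteq> N" "N \<subseteq> closure D" "local_density X x = |D|"
      using local_density_attained[OF x] by blast
    then obtain U where U: "openin (top_of_set X) U" "x \<in> U" "U \<subseteq> N" "N \<subseteq> X"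
      unfolding nbhd_in_def by blast
    then obtain e where e: "e > 0" "cball x e \<inter> X \<subseteq> U" unfolding openin_contains_cball by blast
    have "cof (ctbl_infinite_subsets |D| ) (\<subseteq>) \<le>o ?\<mu>"
      using ordLeq_transitive[OF s(2)[OF x] s_le] D(4) by simp
    moreover have "D \<subseteq> X" using D(2) U(4) by blast
    ultimately obtain \<G> where \<G>: "|\<G>| \<le>o ?\<mu>" "\<G> \<subseteq> compacts X"
      "\<And>K. compact K \<Longrightarrow> K \<subseteq> X \<Longrightarrow> K \<subseteq> closure D \<Longrightarrow> \<exists>G\<in>\<G>. K \<subseteq> G"
      using local_dominating_family[OF X \<mu> dom_le] by blast
    have "cball x e \<inter> X \<subseteq> closure D" using e(2) U(3) D(3) by blast
    then have "\<forall>K. compact K \<and> K \<subseteq> cball x e \<inter> X \<longrightarrow> (\<exists>G\<in>\<G>. K \<subseteq> G)"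
      using \<G>(3) by (meson Int_subset_iff subset_trans)
    then show "\<exists>e>0. \<exists>\<G>. |\<G>| \<le>o ?\<mu> \<and> \<G> \<subseteq> compacts X \<and>
        (\<forall>K. compact K \<and> K \<subseteq> cball x e \<inter> X \<longrightarrow> (\<exists>G\<in>\<G>. K \<subseteq> G))"
      using e(1) \<G>(1,2) by blast
  qed
  moreover have "?\<mu> \<le>o cof (compacts X) (\<subseteq>)"
  proof -
    obtain C where C: "cofinal_in (compacts X) (\<subseteq>) C" "cof (compacts X) (\<subseteq>) = |C|"
      using cof_attained[of "compacts X" "(\<subseteq>)"] by auto
    have inf: "Cinfinite |C|"
      using infinite_cofinal_compacts[OF nc C(1)]
      by (simp add: cinfinite_card_of_iff card_of_Card_order)
    have "?s \<le>o |C|"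
      by (rule sup_card_least[OF F card_of_Card_order])
        (rule cof_ctbl_infinite_subsets_le_cofinal_compacts[OF _ C(1)])
    then have "dominating_number *c ?s \<le>o |C|"
      using dominating_number_le_cofinal_compacts[OF X x0 C(1)] dom s(1) inf
      by (intro cprod_cinfinite_bound)
    then have "?\<mu> \<le>o |C|"
      using dense_char_le_cofinal_compacts[OF nc C(1)] d Card_order_cprod inf
      by (intro cprod_cinfinite_bound[of "dense_char X"]) auto
    then show ?thesis using C(2) by simp
  qed
  ultimately show ?thesis by (simp add: ordIso_iff_ordLeq)
qed

theorem theorem4p8:
  fixes X :: "'a::metric_space set"
  assumes "complete X"
  shows "(\<not> compact X \<and> locally compact X \<longrightarrow> cof (compacts X) (\<subseteq>) =o dense_char X) \<and>
    (\<not> locally compact X \<longrightarrow>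
      cof (compacts X) (\<subseteq>) =o
        dense_char X *c dominating_number *c
          sup_card X (\<lambda>x. cof (ctbl_infinite_subsets (local_density X x)) (\<subseteq>)))"
  by (intro conjI impI cof_compacts_locally_compact cof_compacts_not_locally_compact[OF assms])
    simp_all

end
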